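(* Let $S$ be an inverse semigroup with zero. Then $S$ is semisimple if and only if its universal groupoid $\mathsf{G}_{u}(S)$ is discrete.
   Context: For an inverse semigroup $S$ the natural partial order is $a\le b$ iff $a=ba^{-1}a$; $a^{\downarrow}=\{x: x\le a\}$ and, for $A\subseteq S$, $A^{\uparrow}=\{x: a\le x\text{ for some }a\in A\}$. $S$ is semisimple if $a^{\downarrow}$ is finite for each $a\in S$. A filter in $S$ is a non-empty subset $F$ with $F^{\uparrow}=F$ such that $a,b\in F$ implies there is $c\in F$ with $c\le a,b$. It is proper if $0\notin F$. For a filter $F$ put $\mathbf{d}(F)=(F^{-1}F)^{\uparrow}$ and $\mathbf{r}(F)=(FF^{-1})^{\uparrow}$. The universal groupoid $\mathsf{G}_{u}(S)$ is the set of all proper filters of $S$, with product $A\cdot B=(AB)^{\uparrow}$ defined iff $\mathbf{d}(A)=\mathbf{r}(B)$, and with the topology whose basis consists of the sets $U_{a;a_{1},\ldots,a_{m}}$ ($a\in S$, $m\ge 0$, $a_{1},\ldots,a_{m}\le a$), where $U_{a;a_{1},\ldots,a_{m}}$ is the set of all proper filters that contain $a$ and omit $a_{1},\ldots,a_{m}$. The groupoid is discrete if this topology is discrete. *)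

theory Defs
  imports "HOL-Analysis.Abstract_Topology" "HOL-Algebra.Congruence"
begin

section \<open>Inverse semigroups with zero\<close>

record 'a semigroup0 = "'a partial_object" +
  smult :: "['a, 'a] \<Rightarrow> 'a" (infixl "\<odot>\<index>" 70)
  szero :: 'a ("\<zero>\<index>")

locale inverse_semigroup0 =
  fixes S :: "('a, 'm) semigroup0_scheme" (structure)
  assumes mult_closed: "\<lbrakk>a \<in> carrier S; b \<in> carrier S\<rbrakk> \<Longrightarrow> a \<odot> b \<in> carrier S"
    and mult_assoc: "\<lbrakk>a \<in> carrier S; b \<in> carrier S; c \<in> carrier S\<rbrakk>
      \<Longrightarrow> (a \<odot> b) \<odot> c = a \<odot> (b \<odot> c)"
    and unique_inverse: "a \<in> carrier S
      \<Longrightarrow> \<exists>!b. b \<in> carrier S \<and> a \<odot> b \<odot> a = a \<and> b \<odot> a \<odot> b = b"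
    and zero_closed: "\<zero> \<in> carrier S"
    and zero_left: "a \<in> carrier S \<Longrightarrow> \<zero> \<odot> a = \<zero>"
    and zero_right: "a \<in> carrier S \<Longrightarrow> a \<odot> \<zero> = \<zero>"

definition sinv :: "('a, 'm) semigroup0_scheme \<Rightarrow> 'a \<Rightarrow> 'a" ("sinv\<index> _" [81] 80) where
  "sinv\<^bsub>S\<^esub> a =
     (THE b. b \<in> carrier S \<and> a \<odot>\<^bsub>S\<^esub> b \<odot>\<^bsub>S\<^esub> a = a \<and> b \<odot>\<^bsub>S\<^esub> a \<odot>\<^bsub>S\<^esub> b = b)"

definition natural_le :: "('a, 'm) semigroup0_scheme \<Rightarrow> 'a \<Rightarrow> 'a \<Rightarrow> bool" (infix "\<preceq>\<index>" 50)
  where "a \<preceq>\<^bsub>S\<^esub> b \<longleftrightarrow> a = b \<odot>\<^bsub>S\<^esub> (sinv\<^bsub>S\<^esub> a) \<odot>\<^bsub>S\<^esub> a"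

definition down :: "('a, 'm) semigroup0_scheme \<Rightarrow> 'a \<Rightarrow> 'a set" where
  "down S a = {x \<in> carrier S. x \<preceq>\<^bsub>S\<^esub> a}"

definition up :: "('a, 'm) semigroup0_scheme \<Rightarrow> 'a set \<Rightarrow> 'a set" where
  "up S A = {x \<in> carrier S. \<exists>a\<in>A. a \<preceq>\<^bsub>S\<^esub> x}"

definition semisimple :: "('a, 'm) semigroup0_scheme \<Rightarrow> bool" where
  "semisimple S \<longleftrightarrow> (\<forall>a\<in>carrier S. finite (down S a))"

definition set_mult :: "('a, 'm) semigroup0_scheme \<Rightarrow> 'a set \<Rightarrow> 'a set \<Rightarrow> 'a set" where
  "set_mult S A B = {a \<odot>\<^bsub>S\<^esub> b |a b. a \<in> A \<and> b \<in> B}"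

definition set_inv :: "('a, 'm) semigroup0_scheme \<Rightarrow> 'a set \<Rightarrow> 'a set" where
  "set_inv S A = {sinv\<^bsub>S\<^esub> a |a. a \<in> A}"


section \<open>Filters\<close>

definition is_filter :: "('a, 'm) semigroup0_scheme \<Rightarrow> 'a set \<Rightarrow> bool" where
  "is_filter S F \<longleftrightarrow>
     F \<subseteq> carrier S \<and> F \<noteq> {} \<and> up S F = F \<and>
     (\<forall>a\<in>F. \<forall>b\<in>F. \<exists>c\<in>F. c \<preceq>\<^bsub>S\<^esub> a \<and> c \<preceq>\<^bsub>S\<^esub> b)"

definition proper_filters :: "('a, 'm) semigroup0_scheme \<Rightarrow> 'a set set" where
  "proper_filters S = {F. is_filter S F \<and> \<zero>\<^bsub>S\<^esub> \<notin> F}"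

definition filter_dom :: "('a, 'm) semigroup0_scheme \<Rightarrow> 'a set \<Rightarrow> 'a set" where
  "filter_dom S F = up S (set_mult S (set_inv S F) F)"

definition filter_ran :: "('a, 'm) semigroup0_scheme \<Rightarrow> 'a set \<Rightarrow> 'a set" where
  "filter_ran S F = up S (set_mult S F (set_inv S F))"

definition filter_comp ::
    "('a, 'm) semigroup0_scheme \<Rightarrow> 'a set \<Rightarrow> 'a set \<Rightarrow> 'a set option" where
  "filter_comp S A B =
     (if A \<in> proper_filters S \<and> B \<in> proper_filters S \<and> filter_dom S A = filter_ran S B
      then Some (up S (set_mult S A B)) else None)"


section \<open>The universal groupoid\<close>

text \<open>A groupoid is given by its set of arrows: identities are identified with objects,
  and the partial product returns \<^term>\<open>None\<close> where it is undefined.\<close>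

record 'g topological_groupoid = "'g partial_object" +
  gdom :: "'g \<Rightarrow> 'g"
  gran :: "'g \<Rightarrow> 'g"
  gcomp :: "'g \<Rightarrow> 'g \<Rightarrow> 'g option"
  gtop :: "'g topology"

definition discrete_groupoid :: "('g, 'm) topological_groupoid_scheme \<Rightarrow> bool" where
  "discrete_groupoid G \<longleftrightarrow> gtop G = discrete_topology (carrier G)"

definition basic_open :: "('a, 'm) semigroup0_scheme \<Rightarrow> 'a \<Rightarrow> 'a set \<Rightarrow> 'a set set" where
  "basic_open S a A = {F \<in> proper_filters S. a \<in> F \<and> F \<inter> A = {}}"

text \<open>The finite set \<^term>\<open>A\<close> is the possibly empty list of omitted elements.\<close>

definition universal_basis :: "('a, 'm) semigroup0_scheme \<Rightarrow> 'a set set set" where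
  "universal_basis S =
     {basic_open S a A |a A. a \<in> carrier S \<and> finite A \<and> A \<subseteq> down S a}"

definition universal_groupoid ::
    "('a, 'm) semigroup0_scheme \<Rightarrow> 'a set topological_groupoid" where
  "universal_groupoid S =
     \<lparr>carrier = proper_filters S,
      gdom = filter_dom S,
      gran = filter_ran S,
      gcomp = filter_comp S,
      gtop = topology_generated_by (universal_basis S)\<rparr>"


section \<open>The generating family is a basis\<close>

text \<open>\<^const>\<open>topology_generated_by\<close> only asks for a subbasis, so we check that every open set is
  a union of members of \<^const>\<open>universal_basis\<close>.\<close>

context inverse_semigroup0
begin

lemma sinv_props:
  assumes "a \<in> carrier S"
  shows "sinv a \<in> carrier S" "a \<odot> (sinv a) \<odot> a = a" "(sinv a) \<odot> a \<odot> (sinv a) = sinv a"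
  using theI'[OF unique_inverse[OF assms]] unfolding sinv_def by auto

lemma sinv_eqI:
  assumes "a \<in> carrier S" "b \<in> carrier S" "a \<odot> b \<odot> a = a" "b \<odot> a \<odot> b = b"
  shows "sinv a = b"
  using unique_inverse[OF assms(1)] sinv_props[OF assms(1)] assms by blast

lemma sinv_cancel:
  assumes a: "a \<in> carrier S"
  shows "a \<odot> (sinv a \<odot> a) = a" "sinv a \<odot> (a \<odot> sinv a) = sinv a"
    "z \<in> carrier S \<Longrightarrow> a \<odot> (sinv a \<odot> (a \<odot> z)) = a \<odot> z"
    "z \<in> carrier S \<Longrightarrow> sinv a \<odot> (a \<odot> (sinv a \<odot> z)) = sinv a \<odot> z"
proof -
  note i = sinv_props[OF a]
  show 1: "a \<odot> (sinv a \<odot> a) = a" and 2: "sinv a \<odot> (a \<odot> sinv a) = sinv a"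
    using i a by (simp_all add: mult_assoc)
  show "a \<odot> (sinv a \<odot> (a \<odot> z)) = a \<odot> z" if "z \<in> carrier S"
    using arg_cong[OF 1, of "\<lambda>t. t \<odot> z"] that by (simp add: mult_assoc mult_closed a i(1))
  show "sinv a \<odot> (a \<odot> (sinv a \<odot> z)) = sinv a \<odot> z" if "z \<in> carrier S"
    using arg_cong[OF 2, of "\<lambda>t. t \<odot> z"] that by (simp add: mult_assoc mult_closed a i(1))
qed

lemma idem_left:
  assumes "e \<in> carrier S" "e \<odot> e = e" "z \<in> carrier S"
  shows "e \<odot> (e \<odot> z) = e \<odot> z"
  using mult_assoc[OF assms(1,1,3)] assms(2) by simp

lemma idem_mult_idem:
  assumes e: "e \<in> carrier S" "e \<odot> e = e" and f: "f \<in> carrier S" "f \<odot> f = f"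
  shows "(e \<odot> f) \<odot> (e \<odot> f) = e \<odot> f"
proof -
  define x where "x = sinv (e \<odot> f)"
  have ef: "e \<odot> f \<in> carrier S" using e f mult_closed by blast
  have x: "x \<in> carrier S" using sinv_props(1)[OF ef] x_def by simp
  note ids = idem_left[OF e] idem_left[OF f]
  have 1: "e \<odot> (f \<odot> (x \<odot> (e \<odot> f))) = e \<odot> f"
    using sinv_props(2)[OF ef] by (simp add: x_def[symmetric] mult_assoc mult_closed e f x)
  have 2: "x \<odot> (e \<odot> (f \<odot> x)) = x"
    using sinv_props(3)[OF ef] by (simp add: x_def[symmetric] mult_assoc mult_closed e f x)
  have 3: "x \<odot> (e \<odot> (f \<odot> (x \<odot> e))) = x \<odot> e"
    using arg_cong[OF 2, of "\<lambda>t. t \<odot> e"] by (simp add: mult_assoc mult_closed e f x)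
  have "sinv (e \<odot> f) = f \<odot> (x \<odot> e)"
    by (rule sinv_eqI) (simp_all add: mult_assoc mult_closed e f x ids 1 3)
  then have fxe: "f \<odot> (x \<odot> e) = x" using x_def by simp
  have "(f \<odot> (x \<odot> e)) \<odot> (f \<odot> (x \<odot> e)) = f \<odot> (x \<odot> e)"
    by (simp add: mult_assoc mult_closed e f x 3)
  then have xx: "x \<odot> x = x" using fxe by simp
  have "sinv x = e \<odot> f"
    by (rule sinv_eqI) (use 1 2 in \<open>simp_all add: mult_assoc mult_closed e f x\<close>)
  moreover have "sinv x = x" by (rule sinv_eqI) (simp_all add: x xx)
  ultimately show ?thesis using xx by simp
qed

lemma idem_commute:
  assumes e: "e \<in> carrier S" "e \<odot> e = e" and f: "f \<in> carrier S" "f \<odot> f = f"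
  shows "e \<odot> f = f \<odot> e"
proof -
  note ids = idem_left[OF e] idem_left[OF f]
  note p = idem_mult_idem[OF e f] and q = idem_mult_idem[OF f e]
  have p': "e \<odot> (f \<odot> (e \<odot> f)) = e \<odot> f" using p by (simp add: mult_assoc mult_closed e f)
  have q': "f \<odot> (e \<odot> (f \<odot> e)) = f \<odot> e" using q by (simp add: mult_assoc mult_closed e f)
  have "sinv (e \<odot> f) = f \<odot> e"
    by (rule sinv_eqI) (simp_all add: mult_assoc mult_closed e f ids p' q')
  moreover have "sinv (e \<odot> f) = e \<odot> f"
    by (rule sinv_eqI) (simp_all add: mult_closed e f p)
  ultimately show ?thesis by simp
qed

lemma sinv_idem:
  assumes "a \<in> carrier S"
  shows "sinv a \<odot> a \<in> carrier S" "(sinv a \<odot> a) \<odot> (sinv a \<odot> a) = sinv a \<odot> a"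
    "a \<odot> sinv a \<in> carrier S" "(a \<odot> sinv a) \<odot> (a \<odot> sinv a) = a \<odot> sinv a"
  by (simp_all add: assms mult_assoc mult_closed sinv_props(1) sinv_cancel(1,2))

lemma sinv_mult_idem:
  assumes a: "a \<in> carrier S" and e: "e \<in> carrier S" "e \<odot> e = e"
  shows "sinv (a \<odot> e) = e \<odot> sinv a"
proof (rule sinv_eqI)
  note i = sinv_props(1)[OF a]
  note c = idem_commute[OF sinv_idem(1,2)[OF a] e]
  have c': "e \<odot> (sinv a \<odot> (a \<odot> z)) = sinv a \<odot> (a \<odot> (e \<odot> z))" if "z \<in> carrier S" for z
    using arg_cong[OF c, of "\<lambda>t. t \<odot> z"] that by (simp add: mult_assoc mult_closed a e i)
  show "a \<odot> e \<in> carrier S" "e \<odot> sinv a \<in> carrier S" using a e i mult_closed by auto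
  show "a \<odot> e \<odot> (e \<odot> sinv a) \<odot> (a \<odot> e) = a \<odot> e"
    by (simp add: mult_assoc mult_closed a e i idem_left[OF e] c' sinv_cancel[OF a])
  show "e \<odot> sinv a \<odot> (a \<odot> e) \<odot> (e \<odot> sinv a) = e \<odot> sinv a"
    by (simp add: mult_assoc mult_closed a e i idem_left[OF e] c'[symmetric] sinv_cancel[OF a])
qed

lemma mult_idem_le:
  assumes a: "a \<in> carrier S" and e: "e \<in> carrier S" "e \<odot> e = e"
  shows "a \<odot> e \<preceq> a"
proof -
  note i = sinv_props(1)[OF a]
  note c = idem_commute[OF sinv_idem(1,2)[OF a] e]
  have c': "e \<odot> (sinv a \<odot> (a \<odot> z)) = sinv a \<odot> (a \<odot> (e \<odot> z))" if "z \<in> carrier S" for z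
    using arg_cong[OF c, of "\<lambda>t. t \<odot> z"] that by (simp add: mult_assoc mult_closed a e i)
  show ?thesis
    unfolding natural_le_def sinv_mult_idem[OF a e]
    by (simp add: mult_assoc mult_closed a e i c' sinv_cancel[OF a])
qed

lemma le_iff_restrict:
  assumes "a \<in> carrier S" "b \<in> carrier S"
  shows "a \<preceq> b \<longleftrightarrow> a = b \<odot> (sinv a \<odot> a)"
  using assms sinv_props by (simp add: natural_le_def mult_assoc)

lemma le_meet:
  assumes d: "d \<in> carrier S" "d \<preceq> x" "d \<preceq> c" and x: "x \<in> carrier S" and c: "c \<in> carrier S"
  shows "d \<preceq> x \<odot> (sinv c \<odot> c)"
proof -
  let ?e = "sinv d \<odot> d" and ?f = "sinv c \<odot> c"
  note e = sinv_idem(1,2)[OF d(1)] and f = sinv_idem(1,2)[OF c]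
  have dx: "d = x \<odot> ?e" and dc: "d = c \<odot> ?e" using d x c by (auto simp: le_iff_restrict)
  have "sinv d = ?e \<odot> sinv c" using sinv_mult_idem[OF c e] dc by simp
  then have "?e = (?e \<odot> sinv c) \<odot> (c \<odot> ?e)" using dc by simp
  also have "\<dots> = ?e \<odot> (?f \<odot> ?e)"
    using sinv_props(1)[OF c] sinv_props(1)[OF d(1)] c d(1)
    by (simp add: mult_assoc mult_closed)
  also have "\<dots> = ?f \<odot> ?e"
    using idem_commute[OF e f] idem_left[OF e] e f mult_closed mult_assoc by metis
  finally have ef: "?f \<odot> ?e = ?e" by simp
  have "(x \<odot> ?f) \<odot> ?e = d" using ef dx mult_assoc[OF x f(1) e(1)] by simp
  then show ?thesis using le_iff_restrict[OF d(1) mult_closed[OF x f(1)]] by simp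
qed

lemma meet_le:
  assumes x: "x \<in> carrier S" "x \<preceq> a" and c: "c \<in> carrier S" "c \<preceq> a" and a: "a \<in> carrier S"
  shows "x \<odot> (sinv c \<odot> c) \<preceq> c"
proof -
  let ?e = "sinv x \<odot> x" and ?f = "sinv c \<odot> c"
  note e = sinv_idem(1,2)[OF x(1)] and f = sinv_idem(1,2)[OF c(1)]
  have xa: "x = a \<odot> ?e" and ca: "c = a \<odot> ?f" using x c a by (auto simp: le_iff_restrict)
  have "x \<odot> ?f = c \<odot> ?e"
    using xa ca idem_commute[OF e f] mult_assoc[OF a e(1) f(1)] mult_assoc[OF a f(1) e(1)] by simp
  then show ?thesis using mult_idem_le[OF c(1) e] by simp
qed

lemma filter_upD:
  "\<lbrakk>F \<in> proper_filters S; a \<in> F; a \<preceq> b; b \<in> carrier S\<rbrakk> \<Longrightarrow> b \<in> F"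
  unfolding proper_filters_def is_filter_def up_def by blast

lemma universal_basis_refine:
  assumes "U \<in> universal_basis S" "V \<in> universal_basis S" "F \<in> U \<inter> V"
  obtains W where "W \<in> universal_basis S" "F \<in> W" "W \<subseteq> U \<inter> V"
proof -
  obtain a A where U: "U = basic_open S a A" and a: "a \<in> carrier S" "finite A" "A \<subseteq> down S a"
    using assms(1) unfolding universal_basis_def by blast
  obtain b B where V: "V = basic_open S b B" and b: "b \<in> carrier S" "finite B" "B \<subseteq> down S b"
    using assms(2) unfolding universal_basis_def by blast
  have F: "F \<in> proper_filters S" "a \<in> F" "b \<in> F" "F \<inter> A = {}" "F \<inter> B = {}"
    using assms(3) U V by (auto simp: basic_open_def)
  then obtain c where c: "c \<in> F" "c \<preceq> a" "c \<preceq> b"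
    unfolding proper_filters_def is_filter_def by blast
  have cS: "c \<in> carrier S" using F c unfolding proper_filters_def is_filter_def by blast
  let ?f = "sinv c \<odot> c"
  define C where "C = (\<lambda>x. x \<odot> ?f) ` (A \<union> B)"
  have AB: "x \<in> carrier S" if "x \<in> A \<union> B" for x using that a b by (auto simp: down_def)
  note f = sinv_idem(1,2)[OF cS]
  have "C \<subseteq> down S c"
    using meet_le[OF _ _ cS] a b c cS mult_closed f
    by (auto simp: C_def down_def)
  then have 1: "basic_open S c C \<in> universal_basis S"
    using a b cS unfolding universal_basis_def C_def by blast
  have "x \<odot> ?f \<notin> F" if "x \<in> A \<union> B" for x
    using filter_upD[OF F(1) _ mult_idem_le[OF AB[OF that] f] AB[OF that]] that F by blast
  then have 2: "F \<in> basic_open S c C" using F c by (auto simp: basic_open_def C_def)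
  have "G \<in> U \<inter> V" if G: "G \<in> basic_open S c C" for G
  proof -
    have G': "G \<in> proper_filters S" "c \<in> G" "G \<inter> C = {}" using G by (auto simp: basic_open_def)
    have "x \<notin> G" if x: "x \<in> A \<union> B" for x
    proof
      assume "x \<in> G"
      then obtain d where d: "d \<in> G" "d \<preceq> x" "d \<preceq> c"
        using G' unfolding proper_filters_def is_filter_def by blast
      have dS: "d \<in> carrier S" using G' d unfolding proper_filters_def is_filter_def by blast
      have "x \<odot> ?f \<in> G"
        using filter_upD[OF G'(1) d(1) le_meet[OF dS d(2,3) AB[OF x] cS]]
          mult_closed[OF AB[OF x] f(1)] by blast
      then show False using G' x by (auto simp: C_def)
    qed
    then show ?thesis
      using filter_upD[OF G'(1,2)] c a b G' by (auto simp: U V basic_open_def)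
  qed
  then show thesis using that[OF 1 2] by blast
qed

lemma openin_universal_groupoid_iff:
  "openin (gtop (universal_groupoid S)) X \<longleftrightarrow> (\<exists>\<B> \<subseteq> universal_basis S. X = \<Union>\<B>)"
proof -
  have "generate_topology_on (universal_basis S) X \<longleftrightarrow> (\<exists>\<B> \<subseteq> universal_basis S. X = \<Union>\<B>)"
  proof
    assume "generate_topology_on (universal_basis S) X"
    then have "\<forall>F\<in>X. \<exists>W\<in>universal_basis S. F \<in> W \<and> W \<subseteq> X"
    proof (induction rule: generate_topology_on.induct)
      case (Int P Q)
      show ?case
      proof
        fix F assume "F \<in> P \<inter> Q"
        then obtain U V where UV: "U \<in> universal_basis S" "F \<in> U" "U \<subseteq> P"
          "V \<in> universal_basis S" "F \<in> V" "V \<subseteq> Q" using Int.IH by blast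
        then have "F \<in> U \<inter> V" by blast
        then obtain W where "W \<in> universal_basis S" "F \<in> W" "W \<subseteq> U \<inter> V"
          by (rule universal_basis_refine[OF UV(1,4)])
        then show "\<exists>W\<in>universal_basis S. F \<in> W \<and> W \<subseteq> P \<inter> Q" using UV(3,6) by blast
      qed
    next
      case (UN K)
      show ?case
      proof
        fix F assume "F \<in> \<Union>K"
        then obtain k where k: "k \<in> K" "F \<in> k" by blast
        then obtain W where "W \<in> universal_basis S" "F \<in> W" "W \<subseteq> k" using UN.IH by blast
        then show "\<exists>W\<in>universal_basis S. F \<in> W \<and> W \<subseteq> \<Union>K" using k by blast
      qed
    qed auto
    then have "X = \<Union>{W \<in> universal_basis S. W \<subseteq> X}" by blast
    moreover have "{W \<in> universal_basis S. W \<subseteq> X} \<subseteq> universal_basis S" by blast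
    ultimately show "\<exists>\<B> \<subseteq> universal_basis S. X = \<Union>\<B>" by blast
  next
    assume "\<exists>\<B> \<subseteq> universal_basis S. X = \<Union>\<B>"
    then obtain \<B> where \<B>: "\<B> \<subseteq> universal_basis S" "X = \<Union>\<B>" by blast
    have "generate_topology_on (universal_basis S) (\<Union>\<B>)"
      by (rule generate_topology_on.UN, rule generate_topology_on.Basis) (use \<B>(1) in blast)
    then show "generate_topology_on (universal_basis S) X" using \<B>(2) by simp
  qed
  then show ?thesis
    unfolding universal_groupoid_def topological_groupoid.simps openin_topology_generated_by_iff .
qed

lemma topspace_universal_groupoid:
  "topspace (gtop (universal_groupoid S)) = carrier (universal_groupoid S)"
proof -
  have "F \<in> \<Union>(universal_basis S)" if F: "F \<in> proper_filters S" for F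
  proof -
    obtain a where "a \<in> F" "a \<in> carrier S"
      using F unfolding proper_filters_def is_filter_def by blast
    then have "F \<in> basic_open S a {}" "basic_open S a {} \<in> universal_basis S"
      using F by (auto simp: basic_open_def universal_basis_def)
    then show ?thesis by blast
  qed
  moreover have "\<Union>(universal_basis S) \<subseteq> proper_filters S"
    unfolding universal_basis_def basic_open_def by blast
  ultimately have "\<Union>(universal_basis S) = proper_filters S" by blast
  then show ?thesis by (simp add: universal_groupoid_def)
qed

end

end

theory Submission
  imports Defs
begin

text \<open>
  A basic set with parameters \<open>a; a\<^sub>1, \<dots>, a\<^sub>m\<close> that is non-empty contains the principal
  filter \<open>a\<^sup>\<up>\<close>.  Hence if it is a singleton \<open>{F}\<close>, then \<open>F = a\<^sup>\<up>\<close>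
  (\<open>isolated_filter_principal\<close>).  Moreover, for \<open>0 \<noteq> x < a\<close> the filter \<open>x\<^sup>\<up>\<close> is then
  excluded from it, that is, \<open>x\<close> lies below one of the \<open>a\<^sub>i\<close>, all of which are strictly below
  \<open>a\<close> (\<open>isolated_principal_finite_cover\<close>).

  If \<open>S\<close> is semisimple, a proper filter meets the finite set \<open>a\<^sup>\<down>\<close> of any of its members in a
  set with a least element, so it is principal; omitting the finitely many elements strictly
  below its generator isolates it.

  Conversely, suppose that the topology is discrete but some \<open>a\<^sup>\<down>\<close> is infinite.  By the finite
  cover, one of the sets \<open>a\<^sub>i\<^sup>\<down>\<close> is infinite again, and repeating this, as in Koenig's lemma,
  gives a strictly descending sequence of non-zero elements.  Its upward closure is a proper
  filter, and being isolated it has a least element, which is absurd.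
\<close>

context inverse_semigroup0
begin

section \<open>The natural partial order\<close>

lemma le_refl: "a \<in> carrier S \<Longrightarrow> a \<preceq> a"
  by (simp add: le_iff_restrict sinv_cancel)

lemma le_trans:
  assumes S: "a \<in> carrier S" "b \<in> carrier S" "c \<in> carrier S" and le: "a \<preceq> b" "b \<preceq> c"
  shows "a \<preceq> c"
proof -
  note e = sinv_idem(1,2)[OF S(1)] and f = sinv_idem(1,2)[OF S(2)]
  have "a = b \<odot> (sinv a \<odot> a)" "b = c \<odot> (sinv b \<odot> b)"
    using S le by (simp_all add: le_iff_restrict)
  then have "a = c \<odot> ((sinv b \<odot> b) \<odot> (sinv a \<odot> a))"
    using mult_assoc[OF S(3) f(1) e(1)] by simp
  then show ?thesis
    using mult_idem_le[OF S(3) mult_closed[OF f(1) e(1)] idem_mult_idem[OF f e]] by simp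
qed

lemma le_antisym:
  assumes S: "a \<in> carrier S" "b \<in> carrier S" and le: "a \<preceq> b" "b \<preceq> a"
  shows "a = b"
proof -
  let ?e = "sinv a \<odot> a" and ?f = "sinv b \<odot> b"
  note e = sinv_idem(1,2)[OF S(1)] and f = sinv_idem(1,2)[OF S(2)]
  have a: "a = b \<odot> ?e" and b: "b = a \<odot> ?f" using S le by (simp_all add: le_iff_restrict)
  have "b = (b \<odot> ?e) \<odot> ?f" using a b by simp
  also have "\<dots> = (b \<odot> ?f) \<odot> ?e"
    using idem_commute[OF e f] mult_assoc[OF S(2) e(1) f(1)] mult_assoc[OF S(2) f(1) e(1)] by simp
  also have "\<dots> = a" using a sinv_cancel(1)[OF S(2)] by simp
  finally show ?thesis by simp
qed

lemma zero_le: "a \<in> carrier S \<Longrightarrow> \<zero> \<preceq> a"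
  using mult_idem_le[OF _ zero_closed zero_left[OF zero_closed], of a] by (simp add: zero_right)

lemma down_mono:
  assumes "x \<in> carrier S" "a \<in> carrier S" "x \<preceq> a"
  shows "down S x \<subseteq> down S a"
  using le_trans[OF _ assms(1,2) _ assms(3)] by (auto simp: down_def)

lemma finite_down_zero: "finite (down S \<zero>)"
proof -
  have "down S \<zero> \<subseteq> {\<zero>}"
    using le_antisym[OF _ zero_closed _ zero_le] by (auto simp: down_def)
  then show ?thesis using finite_subset by blast
qed


section \<open>Principal filters and filters of chains\<close>

text \<open>A principal filter is the case of a constant sequence, so both kinds of filter used in
  the proof come from this one construction.\<close>

lemma chain_up_proper_filter:
  fixes f :: "nat \<Rightarrow> 'a"
  assumes f: "\<And>n. f n \<in> carrier S" "\<And>n. f n \<noteq> \<zero>" "\<And>n. f (Suc n) \<preceq> f n"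
  shows "up S (range f) \<in> proper_filters S"
proof -
  have mono: "f n \<preceq> f m" if "m \<le> n" for m n
    using that
  proof (induction rule: dec_induct)
    case base
    show ?case using le_refl f(1) by blast
  next
    case (step k)
    show ?case using le_trans[OF f(1) f(1) f(1) f(3) step.IH] .
  qed
  have mem: "x \<in> up S (range f) \<longleftrightarrow> x \<in> carrier S \<and> (\<exists>n. f n \<preceq> x)" for x
    by (auto simp: up_def)
  have range: "f n \<in> up S (range f)" for n
    using mem f(1) le_refl by blast
  have "up S (up S (range f)) = up S (range f)"
  proof
    show "up S (up S (range f)) \<subseteq> up S (range f)"
      using le_trans[OF f(1)] by (auto simp: up_def)
    show "up S (range f) \<subseteq> up S (up S (range f))"
      using le_refl unfolding up_def by blast
  qed
  moreover have "\<exists>c\<in>up S (range f). c \<preceq> x \<and> c \<preceq> y"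
    if xy: "x \<in> up S (range f)" "y \<in> up S (range f)" for x y
  proof -
    obtain m n where mn: "f m \<preceq> x" "f n \<preceq> y" "x \<in> carrier S" "y \<in> carrier S"
      using xy mem by blast
    have "f (max m n) \<preceq> f m" "f (max m n) \<preceq> f n" using mono by simp_all
    then have "f (max m n) \<preceq> x" "f (max m n) \<preceq> y"
      using le_trans[OF f(1) f(1) mn(3) _ mn(1)] le_trans[OF f(1) f(1) mn(4) _ mn(2)] by blast+
    then show ?thesis using range by blast
  qed
  moreover have "\<zero> \<notin> up S (range f)"
    using mem le_antisym[OF f(1) zero_closed _ zero_le[OF f(1)]] f(2) by blast
  ultimately show ?thesis
    using range mem unfolding proper_filters_def is_filter_def by blast
qed

lemma principal_proper_filter:
  assumes "a \<in> carrier S" "a \<noteq> \<zero>"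
  shows "up S {a} \<in> proper_filters S"
  using chain_up_proper_filter[of "\<lambda>_. a"] assms le_refl by simp

lemma mem_principal: "x \<in> up S {a} \<longleftrightarrow> x \<in> carrier S \<and> a \<preceq> x"
  by (simp add: up_def)

lemma proper_filter_subset: "F \<in> proper_filters S \<Longrightarrow> F \<subseteq> carrier S"
  by (simp add: proper_filters_def is_filter_def)

lemma proper_filter_lower_bound:
  assumes "F \<in> proper_filters S" "a \<in> F" "b \<in> F"
  obtains c where "c \<in> F" "c \<in> carrier S" "c \<preceq> a" "c \<preceq> b"
  using assms unfolding proper_filters_def is_filter_def by blast

text \<open>Among the finitely many members of the filter below \<open>a\<close>, one with the fewest elements
  below it is minimal; directedness of the filter makes it least.\<close>

lemma proper_filter_principal_if_finite_down:
  assumes F: "F \<in> proper_filters S" and a: "a \<in> F" "finite (down S a)"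
  obtains m where "m \<in> carrier S" "m \<noteq> \<zero>" "m \<preceq> a" "F = up S {m}"
proof -
  have sub: "F \<subseteq> carrier S" using proper_filter_subset F .
  then have aS: "a \<in> carrier S" using a by blast
  obtain m where m: "m \<in> F" "m \<preceq> a"
    and min: "\<And>x. \<lbrakk>x \<in> F; x \<preceq> a\<rbrakk> \<Longrightarrow> card (down S m) \<le> card (down S x)"
    using ex_has_least_nat[of "\<lambda>x. x \<in> F \<and> x \<preceq> a" a "\<lambda>x. card (down S x)"] a(1) le_refl[OF aS]
    by blast
  have mS: "m \<in> carrier S" using m sub by blast
  have "m \<preceq> x" if x: "x \<in> F" for x
  proof -
    obtain c where c: "c \<in> F" "c \<in> carrier S" "c \<preceq> m" "c \<preceq> x"
      using proper_filter_lower_bound[OF F m(1) x] .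
    have "c \<preceq> a" using le_trans[OF c(2) mS aS c(3) m(2)] .
    then have "card (down S m) \<le> card (down S c)" using min c by blast
    moreover have "finite (down S m)"
      using finite_subset[OF down_mono[OF mS aS m(2)] a(2)] .
    ultimately have "down S c = down S m"
      using card_seteq down_mono[OF c(2) mS c(3)] by blast
    then have "m \<preceq> c" using mS le_refl by (auto simp: down_def)
    then show ?thesis using le_trans[OF mS c(2) _ _ c(4)] x sub by blast
  qed
  then have "F = up S {m}"
    using filter_upD[OF F m(1)] sub by (auto simp: mem_principal)
  moreover have "m \<noteq> \<zero>" using m F by (auto simp: proper_filters_def)
  ultimately show thesis using that mS m by blast
qed


section \<open>Isolated points of the universal groupoid\<close>

lemma discrete_iff_singletons_basic:
  "discrete_groupoid (universal_groupoid S) \<longleftrightarrow>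
     (\<forall>F\<in>proper_filters S. {F} \<in> universal_basis S)"
proof -
  have "openin (gtop (universal_groupoid S)) {F} \<longleftrightarrow> {F} \<in> universal_basis S" for F
  proof
    assume "openin (gtop (universal_groupoid S)) {F}"
    then obtain \<B> where \<B>: "\<B> \<subseteq> universal_basis S" "{F} = \<Union>\<B>"
      unfolding openin_universal_groupoid_iff by blast
    then obtain W where W: "W \<in> \<B>" "F \<in> W" by blast
    have "W \<subseteq> {F}" using Union_upper[OF W(1)] \<B>(2) by simp
    then have "W = {F}" using W(2) by auto
    then show "{F} \<in> universal_basis S" using W(1) \<B>(1) by auto
  next
    assume "{F} \<in> universal_basis S"
    then show "openin (gtop (universal_groupoid S)) {F}"
      unfolding openin_universal_groupoid_iff by (intro exI[of _ "{{F}}"]) simp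
  qed
  moreover have "carrier (universal_groupoid S) = proper_filters S"
    by (simp add: universal_groupoid_def)
  ultimately show ?thesis
    unfolding discrete_groupoid_def
    using discrete_topology_unique[of "proper_filters S" "gtop (universal_groupoid S)"]
      topspace_universal_groupoid by auto
qed

text \<open>A filter containing \<open>m\<close> and nothing strictly below it has \<open>m\<close> as its least element, by
  directedness.\<close>

lemma principal_filter_isolated:
  assumes m: "m \<in> carrier S" "m \<noteq> \<zero>" "finite (down S m)"
  shows "{up S {m}} \<in> universal_basis S"
proof -
  let ?A = "down S m - {m}"
  have "G = up S {m}" if "G \<in> basic_open S m ?A" for G
  proof -
    have G: "G \<in> proper_filters S" "m \<in> G" "G \<inter> ?A = {}"
      using that by (auto simp: basic_open_def)
    have "m \<preceq> x" if x: "x \<in> G" for x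
    proof -
      obtain c where "c \<in> G" "c \<in> carrier S" "c \<preceq> m" "c \<preceq> x"
        using proper_filter_lower_bound[OF G(1,2) x] .
      then show ?thesis using G(3) by (auto simp: down_def)
    qed
    then show ?thesis
      using filter_upD[OF G(1,2)] proper_filter_subset[OF G(1)] by (auto simp: mem_principal)
  qed
  moreover have "up S {m} \<in> basic_open S m ?A"
    using principal_proper_filter m le_refl le_antisym
    by (auto simp: basic_open_def mem_principal down_def)
  ultimately have "basic_open S m ?A = {up S {m}}" by blast
  then show ?thesis
    using m unfolding universal_basis_def by (auto intro!: exI[of _ m] exI[of _ ?A])
qed

text \<open>Because \<open>F\<close> lies in the basic set, \<open>a\<close> is neither zero nor one of the omitted elements;
  so \<open>a\<^sup>\<up>\<close> lies in it as well and has to be \<open>F\<close>.\<close>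

lemma isolated_filter_principal:
  assumes F: "{F} = basic_open S a A" and a: "a \<in> carrier S" "A \<subseteq> down S a"
  shows "a \<notin> A" "F = up S {a}"
proof -
  have F': "F \<in> proper_filters S" "a \<in> F" "F \<inter> A = {}"
    using F by (auto simp: basic_open_def)
  show aA: "a \<notin> A" using F' by blast
  have "a \<noteq> \<zero>" using F' by (auto simp: proper_filters_def)
  moreover have "up S {a} \<inter> A = {}"
    using aA le_antisym[OF a(1)] a(2) by (fastforce simp: mem_principal down_def)
  ultimately have "up S {a} \<in> basic_open S a A"
    using a principal_proper_filter le_refl by (auto simp: basic_open_def mem_principal)
  then show "F = up S {a}" using F by blast
qed

text \<open>For \<open>0 \<noteq> x < a\<close> the filter \<open>x\<^sup>\<up>\<close> contains \<open>a\<close> but differs from \<open>a\<^sup>\<up>\<close>, so it contains one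
  of the finitely many omitted elements.\<close>

lemma isolated_principal_finite_cover:
  assumes a: "a \<in> carrier S" and iso: "{up S {a}} \<in> universal_basis S"
  obtains A where "finite A" "A \<subseteq> down S a - {a}" "down S a \<subseteq> {\<zero>, a} \<union> (\<Union>x\<in>A. down S x)"
proof -
  obtain b A where b: "{up S {a}} = basic_open S b A" "b \<in> carrier S" "finite A" "A \<subseteq> down S b"
    using iso unfolding universal_basis_def by blast
  have eq: "b \<notin> A" "up S {a} = up S {b}"
    using isolated_filter_principal b by blast+
  have "a \<preceq> b" "b \<preceq> a" using eq(2) a b(2) le_refl mem_principal by blast+
  then have ba: "b = a" using le_antisym a b(2) by blast
  have "\<exists>y\<in>A. x \<preceq> y" if x: "x \<in> carrier S" "x \<preceq> a" "x \<noteq> \<zero>" "x \<noteq> a" for x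
  proof (rule ccontr)
    assume "\<not> ?thesis"
    then have "up S {x} \<in> basic_open S a A"
      using principal_proper_filter x a by (auto simp: basic_open_def mem_principal)
    then have "up S {x} = up S {a}" using b(1) ba by blast
    then have "a \<preceq> x" using x(1) le_refl mem_principal by blast
    then show False using le_antisym x a by blast
  qed
  then have "down S a \<subseteq> {\<zero>, a} \<union> (\<Union>x\<in>A. down S x)"
    by (auto simp: down_def)
  moreover have "A \<subseteq> down S a - {a}" using b eq ba by blast
  ultimately show thesis using that b(3) by blast
qed


section \<open>Semisimplicity and discreteness\<close>

lemma semisimple_imp_isolated:
  assumes "semisimple S" and F: "F \<in> proper_filters S"
  shows "{F} \<in> universal_basis S"
proof -
  obtain a where a: "a \<in> F" "a \<in> carrier S"
    using F unfolding proper_filters_def is_filter_def by blast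
  have fin: "finite (down S x)" if "x \<in> carrier S" for x
    using assms(1) that by (simp add: semisimple_def)
  obtain m where m: "m \<in> carrier S" "m \<noteq> \<zero>" "m \<preceq> a" "F = up S {m}"
    using proper_filter_principal_if_finite_down[OF F a(1) fin[OF a(2)]] .
  show ?thesis using principal_filter_isolated m fin by blast
qed

lemma isolated_imp_semisimple:
  assumes iso: "\<And>F. F \<in> proper_filters S \<Longrightarrow> {F} \<in> universal_basis S"
  shows "semisimple S"
proof (rule ccontr)
  define Inf_down where "Inf_down = {x \<in> carrier S. infinite (down S x)}"
  assume "\<not> semisimple S"
  then obtain a where a: "a \<in> Inf_down" unfolding semisimple_def Inf_down_def by blast
  have nonzero: "x \<noteq> \<zero>" if "x \<in> Inf_down" for x
    using that finite_down_zero by (auto simp: Inf_down_def)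
  have step: "\<exists>y. y \<in> Inf_down \<and> y \<preceq> x \<and> y \<noteq> x" if x: "x \<in> Inf_down" for x
  proof -
    have xS: "x \<in> carrier S" and inf: "infinite (down S x)"
      using x by (auto simp: Inf_down_def)
    obtain A where A: "finite A" "A \<subseteq> down S x - {x}"
      "down S x \<subseteq> {\<zero>, x} \<union> (\<Union>y\<in>A. down S y)"
      using isolated_principal_finite_cover[OF xS iso[OF principal_proper_filter[OF xS nonzero[OF x]]]] .
    have "infinite (\<Union>y\<in>A. down S y)"
      using inf finite_subset[OF A(3)] by auto
    then obtain y where "y \<in> A" "infinite (down S y)" using A(1) by blast
    then show ?thesis using A(2) by (auto simp: Inf_down_def down_def)
  qed
  obtain f :: "nat \<Rightarrow> 'a"
    where f: "\<And>n. f n \<in> Inf_down" "\<And>n. f (Suc n) \<preceq> f n" "\<And>n. f (Suc n) \<noteq> f n"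
    using dependent_nat_choice[of "\<lambda>_ x. x \<in> Inf_down" "\<lambda>_ x y. y \<preceq> x \<and> y \<noteq> x"] a step by blast
  have fS: "f n \<in> carrier S" for n using f(1) by (auto simp: Inf_down_def)
  have "up S (range f) \<in> proper_filters S"
    using chain_up_proper_filter[of f] fS nonzero[OF f(1)] f(2) by blast
  then have "{up S (range f)} \<in> universal_basis S" by (rule iso)
  then obtain m A where mA: "{up S (range f)} = basic_open S m A" "m \<in> carrier S" "A \<subseteq> down S m"
    unfolding universal_basis_def by blast
  have m: "up S (range f) = up S {m}" using isolated_filter_principal(2)[OF mA] .
  have "m \<in> up S (range f)" using m mA(2) le_refl mem_principal by blast
  then obtain n where n: "f n \<preceq> m" by (auto simp: up_def)
  \<comment> \<open>The least element \<open>m\<close> of the filter lies below \<open>f (Suc n)\<close>, so \<open>f n \<preceq> f (Suc n)\<close>.\<close>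
  have "f (Suc n) \<in> up S (range f)" using fS le_refl by (auto simp: up_def)
  then have "m \<preceq> f (Suc n)" using m mem_principal by blast
  then have "f n \<preceq> f (Suc n)" using le_trans[OF fS mA(2) fS n] by blast
  then show False using le_antisym[OF fS fS f(2)] f(3) by blast
qed

end

theorem theorem5p16:
  fixes S :: "('a, 'm) semigroup0_scheme"
  assumes "inverse_semigroup0 S"
  shows "semisimple S \<longleftrightarrow> discrete_groupoid (universal_groupoid S)"
proof -
  interpret inverse_semigroup0 S by (fact assms)
  show ?thesis
    unfolding discrete_iff_singletons_basic
    using semisimple_imp_isolated isolated_imp_semisimple by blast
qed

end
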